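(* Let $\mathcal K_{r,\rho}$ be the trajectory of a symmetrical configuration of the first kind with spectral parameter $r=m/n\in(-2,-1/2)$, $m,n\in\mathbb Z$, $\gcd(m,n)=1$, $m<0$ (so $n>0$), and Clifford parameter $\rho$, $(r,\rho)\in\mathfrak A$. Then its Maslov index is $-(n+m)$.
   Context: $\mathbb C^{2,1}$ is $\mathbb C^3$ with the Hermitian form $\langle \mathbf z,\mathbf w\rangle={}^t\overline{\mathbf z}\,\mathbf h\,\mathbf w$, $\mathbf h=\begin{pmatrix}0&0&i\\0&1&0\\-i&0&0\end{pmatrix}$. $\mathcal N$ is the set of nonzero null vectors, $\mathcal S=\{[\mathbf z]\in\mathbb{CP}^2:\langle\mathbf z,\mathbf z\rangle=0\}$. A lift of a smooth curve $\gamma:\mathbb R\to\mathcal S$ is a smooth $\Gamma={}^t(\Gamma_1,\Gamma_2,\Gamma_3):\mathbb R\to\mathcal N$ with $\gamma=[\Gamma]$. $\gamma$ is (positively parametrized) transversal if $-i\langle\Gamma,\Gamma'\rangle>0$, and generic if $\det(\Gamma,\Gamma',\Gamma'')$ never vanishes. A Wilczynski lift has $\det(\Gamma,\Gamma',\Gamma'')=-1$ (unique up to cube roots of unity); the parametrization is natural if moreover $i\langle\Gamma,\Gamma'\rangle^{-1}=1$. Maslov index. Let $\gamma$ be a natural parametrization of a closed generic transversal curve and $\Gamma$ a Wilczynski lift, which is periodic; let $\omega_\Gamma$ be its minimal period. Then $\chi=\Gamma_1-i\Gamma_3$ is nowhere zero and the Maslov index is the integer $$\mu=\frac{i}{2\pi}\int_0^{\omega_\Gamma}\chi^{-1}\,d\chi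 .$$ Symmetrical configurations of the first kind. Let $$\mathfrak A=\Big\{(r,\rho)\in(-2,-\tfrac12)\times(0,\sqrt2):\rho<\sqrt{\tfrac{2(-3+2\sqrt{2-r-r^2})}{1+2r}}\Big\},$$ $$\mu_1(r,\rho)=\frac{4+8r+12\rho^2+(1+2r)\rho^4}{4+8r+12\rho^2+(1+2r)\rho^4-2\big((2+3r-3r^2-2r^3)(-4\rho+\rho^5)\big)^{2/3}}\in(0,1),$$ $e_1^1=r\frac{\mu_1}{1-\mu_1}$, $e_1^2=-(1+r)\frac{\mu_1}{1-\mu_1}$, $e_1^3=\frac{\mu_1}{1-\mu_1}$, $D_1(r,\rho)=\mathrm{diag}(-ie_1^2,-ie_1^3,-ie_1^1)$, $\mathcal U=\begin{pmatrix}\frac1{\sqrt2}&0&\frac i{\sqrt2}\\0&1&0\\\frac i{\sqrt2}&0&\frac1{\sqrt2}\end{pmatrix}$, $S(\rho)=[{}^t(1,\rho,i\rho^2/2)]\in\mathcal S$. For $(r,\rho)\in\mathfrak A$, $r\in\mathbb Q$, the symmetrical configuration of the first kind with spectral parameter $r$ and Clifford parameter $\rho$ is $\gamma_{r,\rho}(s)=\big(\mathcal U\exp(sD_1(r,\rho))\,\mathcal U^{-1}\big)S(\rho)$; it is a natural parametrization of a generic transversal knot $\mathcal K_{r,\rho}$ (its trajectory). *)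

theory Defs
  imports "HOL-Analysis.Analysis"
begin

definition hmat :: "complex^3^3" where
  "hmat = vector [vector [0, 0, \<i>], vector [0, 1, 0], vector [- \<i>, 0, 0]]"

definition herm :: "complex^3 \<Rightarrow> complex^3 \<Rightarrow> complex" where
  "herm z w = (\<Sum>j\<in>UNIV. cnj (z $ j) * (hmat *v w) $ j)"

definition null_vectors :: "(complex^3) set" where
  "null_vectors = {z. z \<noteq> 0 \<and> herm z z = 0}"

text \<open>For \<open>z \<noteq> 0\<close>, the point \<open>[z]\<close> of the complex projective plane is the complex line through \<open>z\<close>.\<close>

definition proj :: "complex^3 \<Rightarrow> (complex^3) set" where
  "proj z = vec.span {z}"

definition proj_act :: "complex^3^3 \<Rightarrow> (complex^3) set \<Rightarrow> (complex^3) set" where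
  "proj_act A L = (\<lambda>z. A *v z) ` L"

definition nth_deriv :: "nat \<Rightarrow> (real \<Rightarrow> complex^3) \<Rightarrow> real \<Rightarrow> complex^3" where
  "nth_deriv k f = ((\<lambda>g t. vector_derivative g (at t)) ^^ k) f"

definition smooth_curve :: "(real \<Rightarrow> complex^3) \<Rightarrow> bool" where
  "smooth_curve f \<longleftrightarrow> (\<forall>k t. nth_deriv k f differentiable (at t))"

text \<open>A curve \<open>\<gamma>\<close> in the sphere \<open>proj ` null_vectors\<close> is smooth iff it has a smooth lift (defined
  on all of \<open>\<real>\<close>), so smoothness of \<open>\<gamma>\<close> is not a separate condition below.\<close>

definition is_lift :: "(real \<Rightarrow> complex^3) \<Rightarrow> (real \<Rightarrow> (complex^3) set) \<Rightarrow> bool" where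
  "is_lift \<Gamma> \<gamma> \<longleftrightarrow> smooth_curve \<Gamma> \<and> (\<forall>t. \<Gamma> t \<in> null_vectors \<and> \<gamma> t = proj (\<Gamma> t))"

definition wdet :: "(real \<Rightarrow> complex^3) \<Rightarrow> real \<Rightarrow> complex" where
  "wdet \<Gamma> t = det (transpose (vector [\<Gamma> t, nth_deriv 1 \<Gamma> t, nth_deriv 2 \<Gamma> t] :: complex^3^3))"

text \<open>The conditions in the next two definitions do not depend on the lift: if \<open>\<Gamma>\<close> is replaced by
  \<open>c \<Gamma>\<close> with \<open>c\<close> smooth and nowhere zero, then \<open>herm \<Gamma> \<Gamma>'\<close> is multiplied by \<open>\<bar>c\<bar>\<^sup>2\<close>, since
  \<open>herm \<Gamma> \<Gamma> = 0\<close>, and the determinant by \<open>c\<^sup>3\<close>.\<close>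

definition transversal :: "(real \<Rightarrow> (complex^3) set) \<Rightarrow> bool" where
  "transversal \<gamma> \<longleftrightarrow> (\<exists>\<Gamma>. is_lift \<Gamma> \<gamma> \<and>
     (\<forall>t. - \<i> * herm (\<Gamma> t) (nth_deriv 1 \<Gamma> t) \<in> \<real> \<and> Re (- \<i> * herm (\<Gamma> t) (nth_deriv 1 \<Gamma> t)) > 0))"

definition generic :: "(real \<Rightarrow> (complex^3) set) \<Rightarrow> bool" where
  "generic \<gamma> \<longleftrightarrow> (\<exists>\<Gamma>. is_lift \<Gamma> \<gamma> \<and> (\<forall>t. wdet \<Gamma> t \<noteq> 0))"

definition wilczynski_lift :: "(real \<Rightarrow> complex^3) \<Rightarrow> (real \<Rightarrow> (complex^3) set) \<Rightarrow> bool" where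
  "wilczynski_lift \<Gamma> \<gamma> \<longleftrightarrow> is_lift \<Gamma> \<gamma> \<and> (\<forall>t. wdet \<Gamma> t = -1)"

text \<open>A Wilczynski lift is unique up to a constant cube root of unity, so the last condition
  does not depend on its choice.\<close>

definition natural_parametrization :: "(real \<Rightarrow> (complex^3) set) \<Rightarrow> bool" where
  "natural_parametrization \<gamma> \<longleftrightarrow> transversal \<gamma> \<and> generic \<gamma> \<and>
     (\<exists>\<Gamma>. wilczynski_lift \<Gamma> \<gamma> \<and> (\<forall>t. \<i> * inverse (herm (\<Gamma> t) (nth_deriv 1 \<Gamma> t)) = 1))"

definition is_period :: "(real \<Rightarrow> 'a) \<Rightarrow> real \<Rightarrow> bool" where
  "is_period f \<omega> \<longleftrightarrow> \<omega> > 0 \<and> (\<forall>t. f (t + \<omega>) = f t)"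

definition is_minimal_period :: "(real \<Rightarrow> 'a) \<Rightarrow> real \<Rightarrow> bool" where
  "is_minimal_period f \<omega> \<longleftrightarrow> is_period f \<omega> \<and> (\<forall>\<omega>'. is_period f \<omega>' \<longrightarrow> \<omega> \<le> \<omega>')"

definition maslov_chi :: "(real \<Rightarrow> complex^3) \<Rightarrow> real \<Rightarrow> complex" where
  "maslov_chi \<Gamma> t = \<Gamma> t $ 1 - \<i> * \<Gamma> t $ 3"

text \<open>\<open>has_maslov_index \<gamma> \<mu>\<close>: the Maslov index of \<open>\<gamma>\<close> is defined and equal to \<open>\<mu>\<close>. That is, \<open>\<gamma>\<close> is
  a natural parametrization of a closed generic transversal curve and every Wilczynski lift has a
  minimal period, has nowhere vanishing \<open>\<chi>\<close>, and gives the value \<open>\<mu>\<close>. A Wilczynski lift exists by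
  \<open>natural_parametrization\<close>, so the quantification over lifts is not vacuous.\<close>

definition has_maslov_index :: "(real \<Rightarrow> (complex^3) set) \<Rightarrow> int \<Rightarrow> bool" where
  "has_maslov_index \<gamma> \<mu> \<longleftrightarrow> natural_parametrization \<gamma> \<and> (\<exists>\<omega>. is_period \<gamma> \<omega>) \<and>
     (\<forall>\<Gamma>. wilczynski_lift \<Gamma> \<gamma> \<longrightarrow>
        (\<forall>t. maslov_chi \<Gamma> t \<noteq> 0) \<and>
        (\<exists>\<omega>. is_minimal_period \<Gamma> \<omega> \<and>
           of_int \<mu> = \<i> / (2 * of_real pi) *
             integral {0..\<omega>} (\<lambda>t. inverse (maslov_chi \<Gamma> t) * vector_derivative (maslov_chi \<Gamma>) (at t))))"

text \<open>The product \<open>*\<close> on \<open>complex^3^3\<close> is componentwise, so neither \<open>^\<close> nor \<open>exp\<close> is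
  available for the matrix product.\<close>

primrec matrix_power :: "complex^3^3 \<Rightarrow> nat \<Rightarrow> complex^3^3" where
  "matrix_power A 0 = mat 1"
| "matrix_power A (Suc k) = A ** matrix_power A k"

definition matrix_exp :: "complex^3^3 \<Rightarrow> complex^3^3" where
  "matrix_exp A = (\<Sum>k. (1 / fact k) *\<^sub>R matrix_power A k)"

definition diag3 :: "complex \<Rightarrow> complex \<Rightarrow> complex \<Rightarrow> complex^3^3" where
  "diag3 a b c = vector [vector [a, 0, 0], vector [0, b, 0], vector [0, 0, c]]"

definition param_region :: "(real \<times> real) set" where
  "param_region = {(r, \<rho>). r \<in> {-2<..<-1/2} \<and> \<rho> \<in> {0<..<sqrt 2} \<and>
     \<rho> < sqrt (2 * (-3 + 2 * sqrt (2 - r - r^2)) / (1 + 2 * r))}"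

text \<open>On \<open>param_region\<close> the base of the power \<open>2/3\<close> is positive, as
  \<open>2 + 3r - 3r\<^sup>2 - 2r\<^sup>3 = (1 - r)(2r + 1)(r + 2) < 0\<close> and \<open>\<rho>\<^sup>5 < 4\<rho>\<close>, so \<open>powr\<close> is the usual power.\<close>

definition mu1 :: "real \<Rightarrow> real \<Rightarrow> real" where
  "mu1 r \<rho> =
     (4 + 8 * r + 12 * \<rho>^2 + (1 + 2 * r) * \<rho>^4) /
     (4 + 8 * r + 12 * \<rho>^2 + (1 + 2 * r) * \<rho>^4
        - 2 * ((2 + 3 * r - 3 * r^2 - 2 * r^3) * (- 4 * \<rho> + \<rho>^5)) powr (2/3))"

definition e11 :: "real \<Rightarrow> real \<Rightarrow> real" where
  "e11 r \<rho> = r * (mu1 r \<rho> / (1 - mu1 r \<rho>))"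

definition e12 :: "real \<Rightarrow> real \<Rightarrow> real" where
  "e12 r \<rho> = - (1 + r) * (mu1 r \<rho> / (1 - mu1 r \<rho>))"

definition e13 :: "real \<Rightarrow> real \<Rightarrow> real" where
  "e13 r \<rho> = mu1 r \<rho> / (1 - mu1 r \<rho>)"

definition D1 :: "real \<Rightarrow> real \<Rightarrow> complex^3^3" where
  "D1 r \<rho> = diag3 (- \<i> * of_real (e12 r \<rho>)) (- \<i> * of_real (e13 r \<rho>)) (- \<i> * of_real (e11 r \<rho>))"

definition Umat :: "complex^3^3" where
  "Umat = vector [vector [1 / of_real (sqrt 2), 0, \<i> / of_real (sqrt 2)],
                  vector [0, 1, 0],
                  vector [\<i> / of_real (sqrt 2), 0, 1 / of_real (sqrt 2)]]"

definition S_point :: "real \<Rightarrow> (complex^3) set" where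
  "S_point \<rho> = proj (vector [1, of_real \<rho>, \<i> * of_real (\<rho>^2) / 2])"

definition sym_config1 :: "real \<Rightarrow> real \<Rightarrow> real \<Rightarrow> (complex^3) set" where
  "sym_config1 r \<rho> s =
     proj_act (Umat ** matrix_exp (s *\<^sub>R D1 r \<rho>) ** matrix_inv Umat) (S_point \<rho>)"

end

theory Submission
  imports Defs
begin

text \<open>In the basis of the columns of \<open>Umat\<close>, with \<open>k = mu1 / (1 - mu1)\<close>, a Wilczynski lift has
  coordinates \<open>w\<^sub>j = a\<^sub>j exp (i \<theta>\<^sub>j s)\<close> with frequencies \<open>\<theta> = ((1 + r) k, - k, - r k)\<close> and nonzero
  constants \<open>a\<^sub>j\<close>. For \<open>r = m / n\<close> in lowest terms all \<open>\<theta>\<^sub>j\<close> are integer multiples of \<open>k / n\<close> and of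
  no larger number, so the minimal period is \<open>2 \<pi> n / k\<close>. As \<open>\<chi>\<close> equals \<open>sqrt 2 w\<^sub>1\<close>, its logarithmic derivative is the constant
  \<open>i (1 + r) k\<close>, and the index is \<open>- (1 + r) n = - (n + m)\<close>.\<close>

section \<open>Componentwise differentiation of curves in complex 3-space\<close>

lemma has_vector_derivative_vecI:
  fixes f :: "real \<Rightarrow> ('a::real_normed_vector)^'n"
  assumes "\<And>i. ((\<lambda>t. f t $ i) has_vector_derivative f' $ i) (at t)"
  shows "(f has_vector_derivative f') (at t)"
proof -
  have "((\<lambda>y. (f y - f t - (y - t) *\<^sub>R f') /\<^sub>R norm (y - t)) \<longlongrightarrow> 0) (at t)"
  proof (rule vec_tendstoI)
    fix i
    have "((\<lambda>y. (f y $ i - f t $ i - (y - t) *\<^sub>R f' $ i) /\<^sub>R norm (y - t)) \<longlongrightarrow> 0) (at t)"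
      using assms[of i] by (simp add: has_vector_derivative_def has_derivative_at_within)
    then show "((\<lambda>y. ((f y - f t - (y - t) *\<^sub>R f') /\<^sub>R norm (y - t)) $ i) \<longlongrightarrow> 0 $ i) (at t)"
      by simp
  qed
  then show ?thesis
    by (simp add: has_vector_derivative_def has_derivative_at_within bounded_linear_scaleR_left)
qed

lemma has_vector_derivative_nth:
  "(f has_vector_derivative f') F \<Longrightarrow> ((\<lambda>t. f t $ i) has_vector_derivative f' $ i) F"
  by (rule bounded_linear.has_vector_derivative[OF bounded_linear_vec_nth])

lemma nth_deriv_eqI:
  assumes "\<And>k t. (G k has_vector_derivative G (Suc k) t) (at t)"
  shows "nth_deriv k (G 0) = G k"
proof (induction k)
  case (Suc k)
  then show ?case
    using vector_derivative_at[OF assms[of k]] by (auto simp: nth_deriv_def)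
qed (simp add: nth_deriv_def)

lemma nth_deriv_1_2_eqI:
  assumes "\<And>t. (f has_vector_derivative f1 t) (at t)" "\<And>t. (f1 has_vector_derivative f2 t) (at t)"
  shows "nth_deriv 1 f = f1" "nth_deriv 2 f = f2"
  using vector_derivative_at[OF assms(1)] vector_derivative_at[OF assms(2)]
  by (simp_all add: nth_deriv_def numeral_2_eq_2)

lemma smooth_curve_has_vector_derivative:
  assumes "smooth_curve f"
  shows "(nth_deriv k f has_vector_derivative nth_deriv (Suc k) f t) (at t)"
proof -
  have "nth_deriv k f differentiable at t"
    using assms by (simp add: smooth_curve_def)
  then have "(nth_deriv k f has_vector_derivative vector_derivative (nth_deriv k f) (at t)) (at t)"
    by (simp add: vector_derivative_works)
  then show ?thesis by (simp add: nth_deriv_def)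
qed

section \<open>Rescaling of lifts and uniqueness of the Wilczynski lift\<close>

text \<open>By the product rule each derivative of \<open>f t *s \<Gamma> t\<close> is
  \<open>f\<close> times that of \<open>\<Gamma>\<close> plus multiples of lower derivatives, and
  these drop out of the alternating determinant.\<close>

lemma wdet_scale:
  assumes "smooth_curve \<Gamma>"
    and "\<And>t. (f has_vector_derivative f1 t) (at t)" "\<And>t. (f1 has_vector_derivative f2 t) (at t)"
  shows "wdet (\<lambda>t. f t *s \<Gamma> t) t = f t ^ 3 * wdet \<Gamma> t"
proof -
  let ?d = "\<lambda>k t. nth_deriv k \<Gamma> t"
  have d: "((\<lambda>t. ?d k t $ i) has_vector_derivative ?d (Suc k) t $ i) (at t)" for k t i
    using smooth_curve_has_vector_derivative[OF assms(1)] by (rule has_vector_derivative_nth)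
  have d0: "?d 0 = \<Gamma>" by (simp add: nth_deriv_def)
  have 1: "((\<lambda>t. f t *s \<Gamma> t) has_vector_derivative (f1 t *s \<Gamma> t + f t *s ?d 1 t)) (at t)" for t
    using d[where k=0] assms(2)
    by (intro has_vector_derivative_vecI) (auto simp: d0 intro!: derivative_eq_intros)
  have 2: "((\<lambda>t. f1 t *s \<Gamma> t + f t *s ?d 1 t) has_vector_derivative
      (f2 t *s \<Gamma> t + 2 * f1 t *s ?d 1 t + f t *s ?d 2 t)) (at t)" for t
    using d[where k=0] d[where k=1] assms(2,3)
    by (intro has_vector_derivative_vecI)
       (auto simp: d0 numeral_2_eq_2 algebra_simps intro!: derivative_eq_intros)
  show ?thesis
    unfolding wdet_def nth_deriv_1_2_eqI[OF 1 2]
    by (simp add: det_3 transpose_def algebra_simps power3_eq_cube)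
qed

lemma has_vector_derivative_quotient:
  fixes f g :: "real \<Rightarrow> 'a::real_normed_field"
  assumes "(f has_vector_derivative f') (at t)" "(g has_vector_derivative g') (at t)" "g t \<noteq> 0"
  shows "((\<lambda>t. f t / g t) has_vector_derivative (f' * g t - f t * g') / (g t * g t)) (at t)"
proof -
  have "(\<lambda>h. (h *\<^sub>R f' * g t - f t * (h *\<^sub>R g')) / (g t * g t)) =
      (\<lambda>h. h *\<^sub>R ((f' * g t - f t * g') / (g t * g t)))"
    by (simp add: scaleR_conv_of_real algebra_simps)
  then show ?thesis
    using has_derivative_divide'[OF assms(1,2)[unfolded has_vector_derivative_def] assms(3)]
    by (simp only: has_vector_derivative_def)
qed

text \<open>The ratio of the lifts has cube 1 by \<open>wdet_scale\<close>, and a continuous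
  function on the line with values among the cube roots of unity is constant. The nonvanishing
  component \<open>i\<close> exhibits the ratio as a quotient of differentiable functions.\<close>

lemma wilczynski_lift_unique:
  assumes "wilczynski_lift \<Gamma> \<gamma>" "wilczynski_lift \<Delta> \<gamma>" and nz: "\<And>t. \<Delta> t $ i \<noteq> 0"
  obtains u where "u ^ 3 = 1" "\<And>t. \<Gamma> t = u *s \<Delta> t"
proof -
  have sm: "smooth_curve \<Gamma>" "smooth_curve \<Delta>" and w: "wdet \<Gamma> t = -1" "wdet \<Delta> t = -1"
    and p: "proj (\<Gamma> t) = proj (\<Delta> t)" for t
    using assms(1,2) by (auto simp: wilczynski_lift_def is_lift_def)
  define f where "f = (\<lambda>t. \<Gamma> t $ i / \<Delta> t $ i)"
  define f1 where "f1 = (\<lambda>t. (nth_deriv 1 \<Gamma> t $ i * \<Delta> t $ i - \<Gamma> t $ i * nth_deriv 1 \<Delta> t $ i)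
     / (\<Delta> t $ i * \<Delta> t $ i))"
  have d0: "nth_deriv 0 h = h" for h by (simp add: nth_deriv_def)
  have dG: "((\<lambda>t. nth_deriv k \<Gamma> t $ i) has_vector_derivative nth_deriv (Suc k) \<Gamma> t $ i) (at t)"
    and dD: "((\<lambda>t. nth_deriv k \<Delta> t $ i) has_vector_derivative nth_deriv (Suc k) \<Delta> t $ i) (at t)"
    for k t
    by (intro has_vector_derivative_nth smooth_curve_has_vector_derivative sm)+
  have f1: "(f has_vector_derivative f1 t) (at t)" for t
    unfolding f_def f1_def
    using has_vector_derivative_quotient[OF dG[of 0] dD[of 0]] nz by (simp add: d0)
  note dG' = dG[of 0, unfolded d0] and dD' = dD[of 0, unfolded d0]
  \<comment> \<open>A second derivative need only exist, since the conclusion of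
    \<open>wdet_scale\<close> does not mention it.\<close>
  have f2: "\<exists>D. (f1 has_vector_derivative D) (at t)" for t
  proof -
    have "((\<lambda>t. nth_deriv 1 \<Gamma> t $ i * \<Delta> t $ i - \<Gamma> t $ i * nth_deriv 1 \<Delta> t $ i) has_vector_derivative
      (nth_deriv 1 \<Gamma> t $ i * nth_deriv (Suc 0) \<Delta> t $ i + nth_deriv (Suc 1) \<Gamma> t $ i * \<Delta> t $ i) -
      (\<Gamma> t $ i * nth_deriv (Suc 1) \<Delta> t $ i + nth_deriv (Suc 0) \<Gamma> t $ i * nth_deriv 1 \<Delta> t $ i)) (at t)"
      by (intro has_vector_derivative_diff has_vector_derivative_mult dG dD dG' dD')
    from has_vector_derivative_quotient[OF this has_vector_derivative_mult[OF dD' dD']]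
    show ?thesis unfolding f1_def using nz by fastforce
  qed
  then obtain f2 where f2: "\<And>t. (f1 has_vector_derivative f2 t) (at t)" by metis
  have eq: "\<Gamma> t = f t *s \<Delta> t" for t
  proof -
    have "\<Gamma> t \<in> vec.span {\<Delta> t}"
      using p[of t] vec.span_base[of "\<Gamma> t" "{\<Gamma> t}"] by (simp add: proj_def)
    \<comment> \<open>Comparing component \<open>i\<close> identifies this scalar with
      \<open>f t\<close>.\<close>
    then obtain c where "\<Gamma> t = c *s \<Delta> t" by (auto simp: vec.span_singleton)
    then show ?thesis using nz[of t] by (simp add: f_def)
  qed
  have f3: "f t ^ 3 = 1" for t
  proof -
    have "wdet (\<lambda>t. f t *s \<Delta> t) t = f t ^ 3 * wdet \<Delta> t"
      by (rule wdet_scale[OF sm(2) f1 f2])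
    then show ?thesis using w[of t] by (simp flip: eq)
  qed
  have "continuous_on UNIV f"
    using f1 by (meson continuous_at_imp_continuous_on has_vector_derivative_continuous)
  moreover have "finite (f ` UNIV)"
    by (rule finite_subset[OF _ finite_roots_unity[of 3]]) (auto simp: f3)
  ultimately have "f constant_on UNIV"
    by (intro continuous_finite_range_constant) auto
  then obtain u where "\<And>t. f t = u" by (auto simp: constant_on_def)
  then show ?thesis using that[of u] f3 eq by simp
qed

section \<open>Curves with exponential coordinates and their Wronskian determinant\<close>

text \<open>In this normal form differentiation multiplies the coefficient \<open>a $ j\<close> by \<open>l $ j\<close>.\<close>

definition expcurve :: "complex^3^3 \<Rightarrow> complex^3 \<Rightarrow> complex^3 \<Rightarrow> real \<Rightarrow> complex^3" where
  "expcurve A a l t = A *v (\<chi> j. a $ j * exp (of_real t * l $ j))"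

lemma has_vector_derivative_expcurve:
  "(expcurve A a l has_vector_derivative expcurve A (\<chi> j. l $ j * a $ j) l t) (at t)"
proof (rule has_vector_derivative_vecI)
  fix i
  have e: "((\<lambda>t. exp (of_real t * c)) has_vector_derivative c * exp (of_real t * c)) (at t)" for c :: complex
    using exp_scaleR_has_vector_derivative_left[of c t] by (simp add: scaleR_conv_of_real)
  show "((\<lambda>t. expcurve A a l t $ i) has_vector_derivative expcurve A (\<chi> j. l $ j * a $ j) l t $ i) (at t)"
    unfolding expcurve_def matrix_vector_mult_def
    by (auto intro!: derivative_eq_intros has_vector_derivative_sum e simp: sum_3 algebra_simps)
qed

lemma nth_deriv_expcurve:
  "nth_deriv k (expcurve A a l) = expcurve A (\<chi> j. l $ j ^ k * a $ j) l"
proof -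
  have "nth_deriv k ((\<lambda>k. expcurve A (\<chi> j. l $ j ^ k * a $ j) l) 0) = expcurve A (\<chi> j. l $ j ^ k * a $ j) l"
  proof (rule nth_deriv_eqI)
    fix k t
    show "(expcurve A (\<chi> j. l $ j ^ k * a $ j) l has_vector_derivative
        expcurve A (\<chi> j. l $ j ^ Suc k * a $ j) l t) (at t)"
      using has_vector_derivative_expcurve[of A "\<chi> j. l $ j ^ k * a $ j" l t]
      by (simp add: mult.assoc)
  qed
  then show ?thesis by simp
qed

lemma smooth_curve_expcurve: "smooth_curve (expcurve A a l)"
  unfolding smooth_curve_def nth_deriv_expcurve
  using has_vector_derivative_expcurve differentiableI_vector by blast

text \<open>\<open>A\<close> factors out by multiplicativity, each row of the remaining matrix
  contributes \<open>a $ j\<close> and its exponential, and what is left is the Vandermonde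
  determinant of the \<open>l $ j\<close>.\<close>

lemma wdet_expcurve:
  "wdet (expcurve A a l) t = det A * (a $ 1 * a $ 2 * a $ 3) *
     ((l $ 2 - l $ 1) * (l $ 3 - l $ 1) * (l $ 3 - l $ 2)) * exp (of_real t * (l $ 1 + l $ 2 + l $ 3))"
proof -
  let ?e = "\<lambda>k. \<chi> j. l $ j ^ k * a $ j * exp (of_real t * l $ j)"
  have "transpose (vector [A *v u, A *v v, A *v w]) = A ** (transpose (vector [u, v, w]) :: complex^3^3)"
    for u v w :: "complex^3"
    by (simp add: vec_eq_iff transpose_def matrix_matrix_mult_def matrix_vector_mult_def forall_3 vector_def)
  then have "wdet (expcurve A a l) t = det A * det (transpose (vector [?e 0, ?e 1, ?e 2]) :: complex^3^3)"
    unfolding wdet_def nth_deriv_expcurve expcurve_def by (simp add: det_mul del: det_transpose)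
  then show ?thesis
    by (simp add: det_3 transpose_def exp_add distrib_left algebra_simps power2_eq_square)
qed

section \<open>The matrix \<open>Umat\<close>, the Hermitian form in its columns, and diagonal
  exponentials\<close>

text \<open>\<open>matrix_inv\<close> is defined by choice, so \<open>B\<close> first serves as the
  witness that the chosen matrix is an inverse.\<close>

lemma matrix_inv_eqI:
  assumes "A ** B = mat 1" "B ** A = mat 1"
  shows "matrix_inv A = B"
proof -
  have inv: "A ** matrix_inv A = mat 1 \<and> matrix_inv A ** A = mat 1"
    unfolding matrix_inv_def by (rule someI) (use assms in blast)
  have "matrix_inv A = (matrix_inv A ** A) ** B"
    by (simp add: assms flip: matrix_mul_assoc)
  then show ?thesis by (simp add: inv)
qed

lemma sqrt2_sq: "complex_of_real (sqrt 2) * complex_of_real (sqrt 2) = 2"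
  by (simp flip: of_real_mult)

lemma matrix_inv_Umat:
  "matrix_inv Umat = vector [vector [1 / of_real (sqrt 2), 0, - \<i> / of_real (sqrt 2)],
     vector [0, 1, 0], vector [- \<i> / of_real (sqrt 2), 0, 1 / of_real (sqrt 2)]]"
  by (rule matrix_inv_eqI)
     (simp_all add: Umat_def vec_eq_iff forall_3 matrix_matrix_mult_def sum_3 mat_def sqrt2_sq)

lemma det_Umat: "det Umat = 1"
  by (simp add: Umat_def det_3 sqrt2_sq)

lemma Umat_mult:
  "Umat *v v = vector [(v $ 1 + \<i> * v $ 3) / of_real (sqrt 2), v $ 2, (\<i> * v $ 1 + v $ 3) / of_real (sqrt 2)]"
  by (simp add: Umat_def vec_eq_iff forall_3 matrix_vector_mult_def sum_3 add_divide_distrib)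

text \<open>The columns of \<open>Umat\<close> form a pseudo-orthonormal basis, with signs (-, +,
  +).\<close>

lemma herm_Umat:
  "herm (Umat *v v) (Umat *v w) = - cnj (v $ 1) * w $ 1 + cnj (v $ 2) * w $ 2 + cnj (v $ 3) * w $ 3"
proof -
  have q: "x / of_real (sqrt 2) * (y / of_real (sqrt 2)) = x * y / 2" for x y :: complex
    by (simp add: sqrt2_sq)
  have h: "herm u w = \<i> * (cnj (u $ 1) * w $ 3) + cnj (u $ 2) * w $ 2 - \<i> * (cnj (u $ 3) * w $ 1)" for u w
    by (simp add: herm_def hmat_def sum_3 matrix_vector_mult_def algebra_simps)
  show ?thesis
    unfolding Umat_mult h vector_3 complex_cnj_divide complex_cnj_complex_of_real q
    by (simp add: field_simps)
qed

lemma matrix_power_diag3: "matrix_power (diag3 a b c) k = diag3 (a ^ k) (b ^ k) (c ^ k)"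
  by (induction k) (simp_all add: diag3_def vec_eq_iff forall_3 matrix_matrix_mult_def sum_3 mat_def)

lemma matrix_exp_diag3: "matrix_exp (diag3 a b c) = diag3 (exp a) (exp b) (exp c)"
proof -
  have s: "(\<lambda>k. x ^ k /\<^sub>R fact k) sums exp x" for x :: complex by (rule exp_converges)
  have "(\<lambda>k. (1 / fact k) *\<^sub>R matrix_power (diag3 a b c) k) sums diag3 (exp a) (exp b) (exp c)"
    unfolding sums_def
  proof (intro vec_tendstoI)
    fix i j
    show "(\<lambda>n. (\<Sum>k<n. (1 / fact k) *\<^sub>R matrix_power (diag3 a b c) k) $ i $ j)
        \<longlonglongrightarrow> diag3 (exp a) (exp b) (exp c) $ i $ j"
      unfolding matrix_power_diag3
      using s[of a] s[of b] s[of c] exhaust_3[of i] exhaust_3[of j]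
      by (auto simp: diag3_def sums_def inverse_eq_divide)
  qed
  then show ?thesis by (simp add: matrix_exp_def sums_unique[symmetric])
qed

lemma proj_act_proj: "proj_act A (proj z) = proj (A *v z)"
  by (auto simp: proj_act_def proj_def vec.span_singleton vector_scalar_commute image_iff)

lemma proj_scale: "c \<noteq> 0 \<Longrightarrow> proj (c *s z) = proj z"
proof -
  assume "c \<noteq> 0"
  then have "\<exists>d. e *s z = d *s (c *s z)" for e
    by (intro exI[of _ "e / c"]) simp
  then show ?thesis
    by (auto simp: proj_def vec.span_singleton image_iff simp del: vector_smult_assoc)
qed

section \<open>Hermitian products, periods and Maslov integral of exponential curves\<close>

lemma scale_expcurve: "u *s expcurve A a l t = expcurve A (u *s a) l t"
  by (simp add: expcurve_def matrix_vector_mult_def vec_eq_iff sum_distrib_left ac_simps)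

text \<open>Imaginary frequencies give factors of modulus 1, which cancel against their conjugates,
  so the product is constant in time.\<close>

lemma herm_expcurve_Umat:
  assumes "\<And>j. Re (l $ j) = 0"
  shows "herm (expcurve Umat a l t) (expcurve Umat b l t) =
    - cnj (a $ 1) * b $ 1 + cnj (a $ 2) * b $ 2 + cnj (a $ 3) * b $ 3"
proof -
  have "cnj (x * exp (of_real t * l $ j)) * (y * exp (of_real t * l $ j)) = cnj x * y" for x y j
  proof -
    have "cnj (l $ j) = - l $ j"
      using assms[of j] by (simp add: complex_eq_iff)
    then have "cnj (exp (of_real t * l $ j)) * exp (of_real t * l $ j) = 1"
      by (simp add: exp_cnj flip: exp_add)
    then show ?thesis by (simp add: ac_simps)
  qed
  then show ?thesis unfolding expcurve_def herm_Umat by (simp only: vec_lambda_beta mult_minus_left)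
qed

text \<open>The injective \<open>A\<close> can be cancelled, then each nonzero coefficient, so
  periodicity is tested on the scalar exponentials.\<close>

lemma is_period_expcurve_iff:
  assumes "invertible A" "\<And>j. a $ j \<noteq> 0"
  shows "is_period (expcurve A a l) \<omega> \<longleftrightarrow> \<omega> > 0 \<and> (\<forall>j. exp (of_real \<omega> * l $ j) = 1)"
proof -
  have inj: "inj ((*v) A)"
    using assms(1) by (simp add: inj_matrix_vector_mult)
  show ?thesis
    unfolding is_period_def expcurve_def inj_eq[OF inj]
    using assms(2) by (auto simp: vec_eq_iff exp_add distrib_right)
qed

text \<open>In the combination defining \<open>maslov_chi\<close> the third column of
  \<open>Umat\<close> cancels and the first contributes twice 1 / sqrt 2.\<close>

lemma maslov_chi_expcurve_Umat:
  "maslov_chi (expcurve Umat a l) t = of_real (sqrt 2) * a $ 1 * exp (of_real t * l $ 1)"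
proof -
  have "x / of_real (sqrt 2) + x / of_real (sqrt 2) = of_real (sqrt 2) * x" for x :: complex
    using sqrt2_sq by (simp add: field_simps)
  from this[of "a $ 1 * exp (of_real t * l $ 1)"] show ?thesis
    by (simp add: maslov_chi_def expcurve_def Umat_mult add_divide_distrib algebra_simps)
qed

lemma integral_maslov_chi_expcurve_Umat:
  assumes "a $ 1 \<noteq> 0" "\<omega> \<ge> 0"
  shows "integral {0..\<omega>} (\<lambda>t. inverse (maslov_chi (expcurve Umat a l) t) *
    vector_derivative (maslov_chi (expcurve Umat a l)) (at t)) = of_real \<omega> * l $ 1"
proof -
  define f where "f = (\<lambda>t. of_real (sqrt 2) * a $ 1 * exp (of_real t * l $ 1))"
  have "((\<lambda>t. exp (of_real t * l $ 1)) has_vector_derivative l $ 1 * exp (of_real t * l $ 1)) (at t)" for t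
    using exp_scaleR_has_vector_derivative_left[of "l $ 1" t] by (simp add: scaleR_conv_of_real)
  then have "(f has_vector_derivative l $ 1 * f t) (at t)" for t
    unfolding f_def by (auto intro!: derivative_eq_intros)
  then have "vector_derivative f (at t) = l $ 1 * f t" for t
    by (rule vector_derivative_at)
  moreover have "f t \<noteq> 0" for t
    using assms(1) by (simp add: f_def)
  ultimately have "inverse (f t) * vector_derivative f (at t) = l $ 1" for t
    by simp
  moreover have "maslov_chi (expcurve Umat a l) = f"
    by (simp add: fun_eq_iff maslov_chi_expcurve_Umat f_def)
  ultimately show ?thesis using assms(2) by (simp add: scaleR_conv_of_real)
qed

section \<open>The explicit lift of the symmetrical configuration\<close>

text \<open>Coordinates of the initial vector (1, \<rho>, i \<rho>^2 / 2) in the columns of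
  \<open>Umat\<close>, with a real scale \<open>c\<close> kept free for the normalisations.\<close>

definition sym_coeff :: "real \<Rightarrow> real \<Rightarrow> complex^3" where
  "sym_coeff c \<rho> = vector [of_real (c * (2 + \<rho>^2) / (2 * sqrt 2)), of_real (c * \<rho>),
     - \<i> * of_real (c * (2 - \<rho>^2) / (2 * sqrt 2))]"

text \<open>The diagonal of \<open>D1\<close>, with \<open>k\<close> standing for
  \<open>mu1 / (1 - mu1)\<close>.\<close>

definition sym_freq :: "real \<Rightarrow> real \<Rightarrow> complex^3" where
  "sym_freq r k = vector [\<i> * of_real ((1 + r) * k), - \<i> * of_real k, - \<i> * of_real (r * k)]"

text \<open>Conjugation by \<open>Umat\<close> makes the flow diagonal in these coordinates; a
  nonzero scale does not move the projective point, so \<open>c\<close> can be fixed later.\<close>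

lemma sym_config1_eq:
  assumes "c \<noteq> 0"
  shows "sym_config1 r \<rho> t =
    proj (expcurve Umat (sym_coeff c \<rho>) (sym_freq r (mu1 r \<rho> / (1 - mu1 r \<rho>))) t)"
proof -
  define k where "k = mu1 r \<rho> / (1 - mu1 r \<rho>)"
  let ?l = "sym_freq r k"
  have D: "t *\<^sub>R D1 r \<rho> = diag3 (of_real t * ?l $ 1) (of_real t * ?l $ 2) (of_real t * ?l $ 3)"
    unfolding D1_def diag3_def sym_freq_def e11_def e12_def e13_def k_def[symmetric]
    by (simp add: vec_eq_iff forall_3 scaleR_conv_of_real[where 'a=complex] algebra_simps)
  have "matrix_inv Umat *v vector [1, of_real \<rho>, \<i> * of_real (\<rho>^2) / 2] = sym_coeff 1 \<rho>"
    unfolding matrix_inv_Umat sym_coeff_def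
    by (simp add: vec_eq_iff forall_3 matrix_vector_mult_def sum_3 field_simps)
  then have "sym_config1 r \<rho> t = proj (Umat *v (matrix_exp (t *\<^sub>R D1 r \<rho>) *v sym_coeff 1 \<rho>))"
    by (simp add: sym_config1_def S_point_def proj_act_proj flip: matrix_vector_mul_assoc)
  also have "matrix_exp (t *\<^sub>R D1 r \<rho>) *v sym_coeff 1 \<rho> = (\<chi> j. sym_coeff 1 \<rho> $ j * exp (of_real t * ?l $ j))"
    unfolding D matrix_exp_diag3
    by (simp add: vec_eq_iff forall_3 matrix_vector_mult_def sum_3 diag3_def)
  also have "proj (Umat *v \<dots>) = proj (of_real c *s expcurve Umat (sym_coeff 1 \<rho>) ?l t)"
    using assms by (simp add: expcurve_def proj_scale)
  also have "of_real c *s expcurve Umat (sym_coeff 1 \<rho>) ?l t = expcurve Umat (sym_coeff c \<rho>) ?l t"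
    unfolding scale_expcurve
    by (rule arg_cong[where f="\<lambda>a. expcurve Umat a ?l t"]) (simp add: vec_eq_iff forall_3 sym_coeff_def)
  finally show ?thesis by (simp add: k_def)
qed

lemma Re_sym_freq: "Re (sym_freq r k $ j) = 0"
  using exhaust_3[of j] by (auto simp: sym_freq_def)

text \<open>Nullity is the identity (2 + \<rho>^2)^2 - (2 - \<rho>^2)^2 = 8 \<rho>^2. In the second
  formula the squared moduli of the coefficients are weighted by the frequencies, which yields the
  numerator of \<open>mu1\<close>.\<close>

lemma herm_sym_lift:
  "herm (expcurve Umat (sym_coeff c \<rho>) (sym_freq r k) t) (expcurve Umat (sym_coeff c \<rho>) (sym_freq r k) t) = 0"
  "herm (expcurve Umat (sym_coeff c \<rho>) (sym_freq r k) t) (nth_deriv 1 (expcurve Umat (sym_coeff c \<rho>) (sym_freq r k)) t)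
     = - \<i> * of_real (c^2 * k * (4 + 8 * r + 12 * \<rho>^2 + (1 + 2 * r) * \<rho>^4) / 8)"
proof -
  define p q where "p = c * (2 + \<rho>^2) / (2 * sqrt 2)" and "q = c * (2 - \<rho>^2) / (2 * sqrt 2)"
  have pq: "p * p = (c * (2 + \<rho>^2))^2 / 8" "q * q = (c * (2 - \<rho>^2))^2 / 8"
    by (simp_all add: p_def q_def power2_eq_square)
  have coeff: "sym_coeff c \<rho> = vector [of_real p, of_real (c * \<rho>), - \<i> * of_real q]"
    by (simp add: sym_coeff_def p_def q_def)
  have "- (p * p) + (c * \<rho>) * (c * \<rho>) + q * q = 0"
    unfolding pq by (simp add: field_simps power2_eq_square)
  then show "herm (expcurve Umat (sym_coeff c \<rho>) (sym_freq r k) t) (expcurve Umat (sym_coeff c \<rho>) (sym_freq r k) t) = 0"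
    unfolding herm_expcurve_Umat[OF Re_sym_freq] coeff
    by (simp add: complex_eq_iff)
  have "(1 + r) * k * (p * p) + k * ((c * \<rho>) * (c * \<rho>)) + r * k * (q * q)
      = c^2 * k * (4 + 8 * r + 12 * \<rho>^2 + (1 + 2 * r) * \<rho>^4) / 8"
    unfolding pq by (simp add: field_simps power2_eq_square power4_eq_xxxx)
  then show "herm (expcurve Umat (sym_coeff c \<rho>) (sym_freq r k) t) (nth_deriv 1 (expcurve Umat (sym_coeff c \<rho>) (sym_freq r k)) t)
     = - \<i> * of_real (c^2 * k * (4 + 8 * r + 12 * \<rho>^2 + (1 + 2 * r) * \<rho>^4) / 8)"
    unfolding nth_deriv_expcurve herm_expcurve_Umat[OF Re_sym_freq] coeff
    by (simp add: sym_freq_def complex_eq_iff algebra_simps)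
qed

text \<open>The frequencies sum to 0, so the determinant is constant in time; the base of the power
  2/3 in \<open>mu1\<close> appears as its polynomial factor.\<close>

lemma wdet_sym_lift:
  "wdet (expcurve Umat (sym_coeff c \<rho>) (sym_freq r k)) t =
     of_real (c^3 * k^3 * ((2 + 3 * r - 3 * r^2 - 2 * r^3) * (- 4 * \<rho> + \<rho>^5)) / 8)"
proof -
  define p q where "p = c * (2 + \<rho>^2) / (2 * sqrt 2)" and "q = c * (2 - \<rho>^2) / (2 * sqrt 2)"
  have pq: "p * q = c^2 * ((2 + \<rho>^2) * (2 - \<rho>^2)) / 8"
    by (simp add: p_def q_def power2_eq_square)
  \<comment> \<open>The third coefficient and the Vandermonde factor each carry a factor -i; paired,
    they leave the real sign -1.\<close>
  have rotate: "x * y * (- \<i> * z) * (- \<i> * w) = - (x * z) * y * w" for x y z w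
    by (simp add: complex_eq_iff algebra_simps)
  have vandermonde: "(sym_freq r k $ 2 - sym_freq r k $ 1) * (sym_freq r k $ 3 - sym_freq r k $ 1) *
      (sym_freq r k $ 3 - sym_freq r k $ 2) = - \<i> * of_real (k^3 * ((2 + r) * (1 + 2 * r) * (1 - r)))"
  proof -
    have "sym_freq r k $ 2 - sym_freq r k $ 1 = - \<i> * of_real (k * (2 + r))"
      "sym_freq r k $ 3 - sym_freq r k $ 1 = - \<i> * of_real (k * (1 + 2 * r))"
      "sym_freq r k $ 3 - sym_freq r k $ 2 = \<i> * of_real (k * (1 - r))"
      by (simp_all add: sym_freq_def complex_eq_iff algebra_simps)
    then show ?thesis by (simp only:) (simp add: complex_eq_iff power3_eq_cube algebra_simps)
  qed
  have sum: "sym_freq r k $ 1 + sym_freq r k $ 2 + sym_freq r k $ 3 = 0"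
    by (simp add: sym_freq_def algebra_simps)
  have "wdet (expcurve Umat (sym_coeff c \<rho>) (sym_freq r k)) t =
      of_real (- (p * q) * (c * \<rho>) * (k^3 * ((2 + r) * (1 + 2 * r) * (1 - r))))"
    unfolding wdet_expcurve det_Umat vandermonde sum sym_coeff_def vector_3 mult_1_left rotate
      p_def[symmetric] q_def[symmetric]
    by simp
  also have "- (p * q) * (c * \<rho>) * (k^3 * ((2 + r) * (1 + 2 * r) * (1 - r))) =
      c^3 * k^3 * (((2 + r) * (1 + 2 * r) * (1 - r)) * (\<rho> * ((\<rho>^2 + 2) * (\<rho>^2 - 2)))) / 8"
    unfolding pq by (simp add: field_simps power2_eq_square power3_eq_cube)
  also have "(2 + r) * (1 + 2 * r) * (1 - r) = 2 + 3 * r - 3 * r^2 - 2 * r^3"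
    by (simp add: algebra_simps power2_eq_square power3_eq_cube)
  also have "\<rho> * ((\<rho>^2 + 2) * (\<rho>^2 - 2)) = - 4 * \<rho> + \<rho>^5"
    by (simp add: algebra_simps eval_nat_numeral)
  finally show ?thesis .
qed

section \<open>Signs on the parameter region and the normalising scale\<close>

text \<open>With x = \<rho>^2 and A the first expression, completing the square gives (1 + 2 r) A =
  ((1 + 2 r) x + 6)^2 - 16 (2 - r - r^2). The bound on \<rho> makes both factors of this difference
  of squares positive, while 1 + 2 r < 0.\<close>

lemma param_region_neg:
  assumes "(r, \<rho>) \<in> param_region"
  shows "4 + 8 * r + 12 * \<rho>^2 + (1 + 2 * r) * \<rho>^4 < 0"
    "(2 + 3 * r - 3 * r^2 - 2 * r^3) * (- 4 * \<rho> + \<rho>^5) > 0"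
proof -
  have r: "-2 < r" "r < -1/2" and \<rho>: "0 < \<rho>" "\<rho> < sqrt 2"
    and l: "\<rho> < sqrt (2 * (-3 + 2 * sqrt (2 - r - r^2)) / (1 + 2 * r))"
    using assms by (auto simp: param_region_def)
  define s where "s = sqrt (2 - r - r^2)"
  define x where "x = \<rho>^2"
  have "(1 - r) * (r + 2) > 0" using r by (intro mult_pos_pos) auto
  then have pos: "2 - r - r^2 > 0" by (simp add: algebra_simps power2_eq_square)
  then have s: "s > 0" "s^2 = 2 - r - r^2" by (simp_all add: s_def)
  have x: "0 < x" "x < 2"
    using \<rho> power_strict_mono[of \<rho> "sqrt 2" 2] by (auto simp: x_def)
  have "x < 2 * (-3 + 2 * s) / (1 + 2 * r)"
  proof -
    \<comment> \<open>\<open>sqrt\<close> is negative on negative reals; here it exceeds \<rho> > 0,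
      so the radicand is positive and the bound may be squared.\<close>
    have "2 * (-3 + 2 * s) / (1 + 2 * r) > 0"
      using l \<rho>(1) unfolding s_def by (meson order_less_trans real_sqrt_gt_0_iff)
    then show ?thesis
      using power_strict_mono[OF l[folded s_def], of 2] \<rho>(1) by (simp add: x_def)
  qed
  then have "x * (1 + 2 * r) > 2 * (-3 + 2 * s)"
    using r by (simp add: field_simps)
  then have "0 < (1 + 2 * r) * x + 6 - 4 * s" by (simp add: algebra_simps)
  moreover from this have "0 < (1 + 2 * r) * x + 6 + 4 * s" using s(1) by simp
  ultimately have "0 < ((1 + 2 * r) * x + 6 - 4 * s) * ((1 + 2 * r) * x + 6 + 4 * s)" by simp
  also have "\<dots> = ((1 + 2 * r) * x + 6)^2 - 16 * s^2"
    by (simp add: algebra_simps power2_eq_square)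
  also have "\<dots> = (1 + 2 * r) * (4 + 8 * r + 12 * x + (1 + 2 * r) * x^2)"
    unfolding s(2) by (simp add: algebra_simps power2_eq_square)
  finally have "4 + 8 * r + 12 * x + (1 + 2 * r) * x^2 < 0"
    using r by (simp add: zero_less_mult_iff)
  then show "4 + 8 * r + 12 * \<rho>^2 + (1 + 2 * r) * \<rho>^4 < 0"
    by (simp add: x_def flip: power_mult)
  \<comment> \<open>The factors are (1 - r)(r + 2)(1 + 2 r) and -\<rho> (2 - x)(2 + x); their two
    negative signs cancel.\<close>
  have "0 < ((1 - r) * (r + 2)) * (- (1 + 2 * r)) * (\<rho> * ((2 - x) * (2 + x)))"
    using r \<rho> x by (intro mult_pos_pos) auto
  also have "\<dots> = (2 + 3 * r - 3 * r^2 - 2 * r^3) * (- 4 * \<rho> + \<rho>^5)"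
    by (simp add: x_def algebra_simps eval_nat_numeral)
  finally show "(2 + 3 * r - 3 * r^2 - 2 * r^3) * (- 4 * \<rho> + \<rho>^5) > 0" .
qed

text \<open>The scale \<open>c = 4 P\<^sup>1\<^sup>/\<^sup>3 / A\<close>, where \<open>A\<close> is the numerator of \<open>mu1\<close> and \<open>P\<close> the base of
  its power \<open>2/3\<close>, meets both normalisations.\<close>

lemma wilczynski_scale:
  assumes "(r, \<rho>) \<in> param_region"
  defines "k \<equiv> mu1 r \<rho> / (1 - mu1 r \<rho>)"
  obtains c where "c \<noteq> 0" "k > 0"
    "c^2 * k * (4 + 8 * r + 12 * \<rho>^2 + (1 + 2 * r) * \<rho>^4) / 8 = -1"
    "c^3 * k^3 * ((2 + 3 * r - 3 * r^2 - 2 * r^3) * (- 4 * \<rho> + \<rho>^5)) / 8 = -1"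
proof -
  define A where "A = 4 + 8 * r + 12 * \<rho>^2 + (1 + 2 * r) * \<rho>^4"
  define P where "P = (2 + 3 * r - 3 * r^2 - 2 * r^3) * (- 4 * \<rho> + \<rho>^5)"
  define p where "p = P powr (1/3)"
  have A: "A < 0" and P: "P > 0"
    using param_region_neg[OF assms(1)] by (auto simp: A_def P_def)
  have p: "p > 0" "p^3 = P" "P powr (2/3) = p^2"
    using P by (simp_all add: p_def powr_powr flip: powr_realpow)
  \<comment> \<open>The common denominator of \<open>mu1\<close> and \<open>1 - mu1\<close> is
    nonzero and cancels in \<open>k\<close>.\<close>
  have "A - 2 * p^2 < 0" using A by (smt (verit) zero_le_power2)
  moreover from this have "1 - A / (A - 2 * p^2) = - 2 * p^2 / (A - 2 * p^2)"
    by (simp add: diff_divide_eq_iff)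
  ultimately have k: "k = - A / (2 * p^2)"
    unfolding k_def mu1_def A_def[symmetric] P_def[symmetric] p(3) by simp
  show thesis
  \<comment> \<open>The determinant condition (c k)^3 p^3 = -8 forces c k = -2 / p for real c, and
    the value of \<open>k\<close> then gives c.\<close>
  proof (rule that[of "4 * p / A"])
    show "4 * p / A \<noteq> 0" "k > 0" using A p(1) by (auto simp: k divide_simps)
    show "(4 * p / A)^2 * k * (4 + 8 * r + 12 * \<rho>^2 + (1 + 2 * r) * \<rho>^4) / 8 = -1"
      unfolding A_def[symmetric] k using A p(1) by (simp add: field_simps power2_eq_square)
    show "(4 * p / A)^3 * k^3 * ((2 + 3 * r - 3 * r^2 - 2 * r^3) * (- 4 * \<rho> + \<rho>^5)) / 8 = -1"
      unfolding P_def[symmetric] p(2)[symmetric] k using A p(1)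
      by (simp add: field_simps eval_nat_numeral)
  qed
qed

section \<open>The minimal period\<close>

text \<open>A period \<omega> has \<omega> k = 2 pi j and \<omega> r k = 2 pi l with integers j and
  l, so m j = n l and n divides j by coprimality. The coefficients are arbitrary nonzero numbers so
  that multiples of one lift are covered too.\<close>

lemma minimal_period_sym_lift:
  fixes m n :: int
  assumes "coprime m n" "n > 0" "r = of_int m / of_int n" "k > 0" "\<And>j. a $ j \<noteq> 0"
  shows "is_minimal_period (expcurve Umat a (sym_freq r k)) (2 * pi * of_int n / k)"
proof -
  have inv: "invertible Umat" by (simp add: invertible_det_nz det_Umat)
  have ex: "exp (of_real \<omega> * (\<i> * of_real x)) = 1 \<longleftrightarrow> (\<exists>j::int. \<omega> * x = of_int (2 * j) * pi)" for \<omega> x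
    by (simp add: exp_eq_1)
  have ex': "exp (- (of_real \<omega> * (\<i> * of_real x))) = 1 \<longleftrightarrow> (\<exists>j::int. \<omega> * x = of_int (2 * j) * pi)" for \<omega> x
    using ex[of \<omega> x] by (simp add: exp_minus)
  have per: "is_period (expcurve Umat a (sym_freq r k)) \<omega> \<longleftrightarrow> \<omega> > 0 \<and>
      (\<exists>j::int. \<omega> * ((1 + r) * k) = of_int (2 * j) * pi) \<and> (\<exists>j::int. \<omega> * k = of_int (2 * j) * pi)
      \<and> (\<exists>j::int. \<omega> * (r * k) = of_int (2 * j) * pi)" for \<omega>
    unfolding is_period_expcurve_iff[OF inv assms(5)] forall_3
    by (simp only: sym_freq_def vector_3 ex ex' mult_minus_left mult_minus_right)
  show ?thesis
    unfolding is_minimal_period_def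
  proof (intro conjI allI impI)
    let ?\<omega> = "2 * pi * of_int n / k"
    have "?\<omega> * ((1 + r) * k) = of_int (2 * (n + m)) * pi" "?\<omega> * k = of_int (2 * n) * pi"
      "?\<omega> * (r * k) = of_int (2 * m) * pi"
      using assms(2,3,4) by (simp_all add: field_simps)
    then show "is_period (expcurve Umat a (sym_freq r k)) ?\<omega>"
      unfolding per using assms(2,4) by (metis divide_pos_pos mult_pos_pos of_int_0_less_iff pi_gt_zero zero_less_numeral)
  next
    fix \<omega> assume "is_period (expcurve Umat a (sym_freq r k)) \<omega>"
    then obtain j l :: int where w: "\<omega> > 0" and j: "\<omega> * k = of_int (2 * j) * pi"
      and l: "\<omega> * (r * k) = of_int (2 * l) * pi"
      unfolding per by blast
    have "of_int (2 * l) * pi = r * (\<omega> * k)"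
      using l by (simp add: algebra_simps)
    then have "(2 * pi) * (r * of_int j) = (2 * pi) * of_int l"
      unfolding j by (simp add: algebra_simps)
    then have "r * of_int j = of_int l" by simp
    then have "real_of_int (m * j) = of_int (n * l)"
      using assms(2,3) by (simp add: field_simps)
    then have "m * j = n * l" by linarith
    then have "n dvd j"
      using assms(1) by (metis coprime_commute coprime_dvd_mult_right_iff dvd_triv_left)
    \<comment> \<open>Divisibility bounds \<open>n\<close> by \<open>j\<close> only for positive
      \<open>j\<close>.\<close>
    moreover have "j > 0"
      using j w assms(4) by (smt (verit) mult_pos_pos mult_nonpos_nonneg of_int_le_0_iff pi_gt_zero)
    ultimately have "n \<le> j" by (simp add: zdvd_imp_le)
    then have "2 * pi * of_int n \<le> \<omega> * k" using j by simp
    then show "2 * pi * of_int n / k \<le> \<omega>" using assms(4) by (simp add: field_simps)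
  qed
qed

section \<open>Evaluation of the Maslov index on all Wilczynski lifts\<close>

theorem proposition4p8:
  fixes m n :: int and r \<rho> :: real
  assumes "coprime m n" and "m < 0"
    and "r = of_int m / of_int n" and "r \<in> {-2<..<-1/2}"
    and "(r, \<rho>) \<in> param_region"
  shows "has_maslov_index (sym_config1 r \<rho>) (- (n + m))"
proof -
  \<comment> \<open>The case n = 0 is excluded as well, since division by zero would give r =
    0.\<close>
  have n: "n > 0"
  proof (rule ccontr)
    assume "\<not> n > 0"
    then have "r \<ge> 0" using assms(2,3) by (simp add: divide_nonpos_nonpos)
    then show False using assms(4) by simp
  qed
  define k where "k = mu1 r \<rho> / (1 - mu1 r \<rho>)"
  obtain c where c: "c \<noteq> 0" "k > 0"
    "c^2 * k * (4 + 8 * r + 12 * \<rho>^2 + (1 + 2 * r) * \<rho>^4) / 8 = -1"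
    "c^3 * k^3 * ((2 + 3 * r - 3 * r^2 - 2 * r^3) * (- 4 * \<rho> + \<rho>^5)) / 8 = -1"
    using wilczynski_scale[OF assms(5)] unfolding k_def by metis
  define \<Delta> where "\<Delta> = expcurve Umat (sym_coeff c \<rho>) (sym_freq r k)"
  let ?\<gamma> = "sym_config1 r \<rho>" and ?\<omega> = "2 * pi * of_int n / k"
  have \<rho>: "0 < \<rho>" "\<rho> < sqrt 2" using assms(5) by (auto simp: param_region_def)
  then have "\<rho>^2 < 2" using power_strict_mono[of \<rho> "sqrt 2" 2] by simp
  then have "c * (2 + \<rho>^2) / (2 * sqrt 2) \<noteq> 0" "c * \<rho> \<noteq> 0" "c * (2 - \<rho>^2) / (2 * sqrt 2) \<noteq> 0"
    using c(1) \<rho>(1) add_pos_nonneg[of 2 "\<rho>\<^sup>2"] by auto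
  then have a: "sym_coeff c \<rho> $ j \<noteq> 0" for j
    using exhaust_3[of j]
    by (auto simp only: sym_coeff_def vector_3 of_real_eq_0_iff mult_eq_0_iff
        neg_equal_0_iff_equal complex_i_not_zero)
  \<comment> \<open>\<open>Umat\<close> leaves the second coordinate alone; this is the nonvanishing
    component that uniqueness of the lift asks for.\<close>
  have \<Delta>2: "\<Delta> t $ 2 \<noteq> 0" for t
    using a[of 2] by (simp add: \<Delta>_def expcurve_def Umat_mult)
  \<comment> \<open>The value i gives both transversality, as -i * i = 1 > 0, and naturality, as i /
    i = 1.\<close>
  have h: "herm (\<Delta> t) (\<Delta> t) = 0" "herm (\<Delta> t) (nth_deriv 1 \<Delta> t) = \<i>" for t
    unfolding \<Delta>_def herm_sym_lift c(3) by simp_all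
  have wd: "wdet \<Delta> t = -1" for t
    unfolding \<Delta>_def wdet_sym_lift c(4) by simp
  have \<gamma>: "?\<gamma> t = proj (\<Delta> t)" for t
    unfolding \<Delta>_def k_def by (rule sym_config1_eq[OF c(1)])
  have "\<Delta> t \<noteq> 0" for t using \<Delta>2[of t] by auto
  then have lift: "is_lift \<Delta> ?\<gamma>"
    by (simp add: is_lift_def null_vectors_def h(1) \<gamma>) (simp add: \<Delta>_def smooth_curve_expcurve)
  then have wl: "wilczynski_lift \<Delta> ?\<gamma>"
    using wd by (simp add: wilczynski_lift_def)
  have nat: "natural_parametrization ?\<gamma>"
    unfolding natural_parametrization_def transversal_def generic_def
    using lift wl h(2) wd by (intro conjI exI[of _ \<Delta>]) auto
  have "is_period \<Delta> ?\<omega>"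
    using minimal_period_sym_lift[OF assms(1) n assms(3) c(2) a]
    by (simp add: \<Delta>_def is_minimal_period_def)
  then have closed: "is_period ?\<gamma> ?\<omega>"
    by (simp add: is_period_def \<gamma>)
  have "(\<forall>t. maslov_chi \<Gamma> t \<noteq> 0) \<and> is_minimal_period \<Gamma> ?\<omega> \<and>
      of_int (- (n + m)) = \<i> / (2 * of_real pi) *
        integral {0..?\<omega>} (\<lambda>t. inverse (maslov_chi \<Gamma> t) * vector_derivative (maslov_chi \<Gamma>) (at t))"
    if wG: "wilczynski_lift \<Gamma> ?\<gamma>" for \<Gamma>
  proof -
    obtain u where u: "u ^ 3 = 1" "\<And>t. \<Gamma> t = u *s \<Delta> t"
      using wilczynski_lift_unique[OF wG wl \<Delta>2] by blast
    \<comment> \<open>The cube root of unity is absorbed into the coefficients, so the formulas for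
      exponential curves apply to every lift.\<close>
    define b where "b = u *s sym_coeff c \<rho>"
    have \<Gamma>: "\<Gamma> = expcurve Umat b (sym_freq r k)"
      by (simp add: fun_eq_iff u(2) \<Delta>_def scale_expcurve b_def)
    have "u \<noteq> 0" using u(1) by auto
    then have b: "b $ j \<noteq> 0" for j using a by (simp add: b_def)
    have "?\<omega> \<ge> 0" using n c(2) by simp
    note I = integral_maslov_chi_expcurve_Umat[OF b[of 1] this, of "sym_freq r k"]
    \<comment> \<open>Since 1 + r = (n + m) / n, period times frequency is 2 pi i (n + m), and the
      prefactor i / (2 pi) supplies the minus sign.\<close>
    have "of_int n * (1 + r) = of_int (n + m)"
      using assms(3) n by (simp add: field_simps)
    then have "of_real ?\<omega> * sym_freq r k $ 1 = 2 * of_real pi * \<i> * of_int (n + m)"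
      using c(2) by (simp add: sym_freq_def complex_eq_iff)
    then have "of_int (- (n + m)) = \<i> / (2 * of_real pi) * (of_real ?\<omega> * sym_freq r k $ 1)"
      by (simp add: field_simps)
    then show ?thesis
      unfolding \<Gamma> I using b minimal_period_sym_lift[OF assms(1) n assms(3) c(2) b]
      by (simp add: maslov_chi_expcurve_Umat)
  qed
  then show ?thesis
    unfolding has_maslov_index_def using nat closed by blast
qed

end
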